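(* Let $n\ge1$, let $D=\{x\in\mathbb{R}^n:0<x_n<x_{n-1}<\dots<x_1\}$, and for $x,y\in D$ let $$H(x,y)=\det\left(h(x_i,y_j)\right)_{i,j=1}^n,\qquad h(x,y)=\frac{2}{\pi}\,\frac{x}{x^2+y^2}\quad (x,y>0),$$ $$\tilde H(x,y)=\left(\int_D H(x,y')\,dy'\right)^{-1}H(x,y).$$ Then for any $y\in D$ and $t>0$, $$\lim_{\substack{x\in D\\ x\to (t,\dots,t)}}\tilde H(x,y)=\frac{1}{M_t}\prod_{j=1}^n(t^2+y_j^2)^{-n}\prod_{1\le i<j\le n}(y_i^2-y_j^2),$$ where $M_t=\int_D\prod_{j=1}^n(t^2+y_j^2)^{-n}\prod_{1\le i<j\le n}(y_i^2-y_j^2)\,dy$ is the corresponding normalisation constant.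
   Context: The function $h(x,\cdot)$ is the density of the first hitting point $iy$ of the positive imaginary axis for two-dimensional Brownian motion in the quadrant $\{\operatorname{Re}z>0,\operatorname{Im}z>0\}$ started at $x>0$ on the real axis, with normal reflection on the positive real axis and absorption on the positive imaginary axis. *)

theory Defs
  imports "HOL-Analysis.Analysis"
begin

text \<open>
  Vectors of \<open>n\<close> reals are indexed by an arbitrary finite linearly ordered type \<open>'n\<close> with
  \<open>n = CARD('n)\<close>; the order of \<open>'n\<close> plays the role of the order of the indices \<open>1, \<dots>, n\<close>.
\<close>

definition h :: "real \<Rightarrow> real \<Rightarrow> real" where
  "h x y = 2 / pi * (x / (x\<^sup>2 + y\<^sup>2))"

definition D :: "(real ^ 'n::{finite,linorder}) set" where
  "D = {x. (\<forall>i. 0 < x $ i) \<and> (\<forall>i j. i < j \<longrightarrow> x $ j < x $ i)}"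

definition H :: "real ^ 'n::{finite,linorder} \<Rightarrow> real ^ 'n::{finite,linorder} \<Rightarrow> real" where
  "H x y = det (\<chi> i j. h (x $ i) (y $ j))"

definition H_tilde :: "real ^ 'n::{finite,linorder} \<Rightarrow> real ^ 'n::{finite,linorder} \<Rightarrow> real" where
  "H_tilde x y = inverse (LINT y':D|lborel. H x y') * H x y"

definition limit_weight :: "real \<Rightarrow> real ^ 'n::{finite,linorder} \<Rightarrow> real" where
  "limit_weight t y =
     (\<Prod>j\<in>UNIV. (t\<^sup>2 + (y $ j)\<^sup>2) powi (- int CARD('n))) *
     (\<Prod>(i, j)\<in>{(i, j). i < j}. (y $ i)\<^sup>2 - (y $ j)\<^sup>2)"

text \<open>The type argument only determines the dimension.\<close>

definition M :: "'n::{finite,linorder} itself \<Rightarrow> real \<Rightarrow> real" where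
  "M _ t = (LINT y:(D :: (real ^ 'n::{finite,linorder}) set)|lborel. limit_weight t y)"

end

theory Submission
  imports Defs "HOL-Probability.Sinc_Integral"
begin

text \<open>
  Write \<open>a\<^sub>i = x\<^sub>i\<^sup>2\<close> and \<open>b\<^sub>j = y\<^sub>j\<^sup>2\<close>. Up to the row factors \<open>2 x\<^sub>i / \<pi>\<close>, the matrix \<open>h(x\<^sub>i, y\<^sub>j)\<close> is the
  Cauchy matrix \<open>1 / (a\<^sub>i + b\<^sub>j)\<close>, so for fixed \<open>x\<close> its determinant is a nonzero constant times
  \<open>W(x, y) = \<Prod>\<^sub>j \<Prod>\<^sub>i (x\<^sub>i\<^sup>2 + y\<^sub>j\<^sup>2)\<^sup>-\<^sup>1 \<cdot> \<Prod>\<^sub>i\<^sub><\<^sub>j (y\<^sub>i\<^sup>2 - y\<^sub>j\<^sup>2)\<close>. The constant contains the factor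
  \<open>\<Prod>\<^sub>i\<^sub><\<^sub>j (x\<^sub>i\<^sup>2 - x\<^sub>j\<^sup>2)\<close>, which degenerates as \<open>x\<close> approaches \<open>(t, \<dots>, t)\<close>, but it cancels in the
  normalised density: \<open>H_tilde x y = W(x, y) / \<integral>\<^sub>D W(x, y') dy'\<close>. This expression still makes sense at
  \<open>x = (t, \<dots>, t)\<close>, where \<open>W\<close> is the limiting weight, so the theorem says that it is continuous there.

  The numerator is clearly continuous. The denominator is treated by dominated convergence: for \<open>x\<^sub>i \<ge> s > 0\<close>
  the inequality \<open>\<bar>A - B\<bar> \<le> (s\<^sup>2 + A) (s\<^sup>2 + B) / s\<^sup>2\<close> (with \<open>A, B \<ge> 0\<close>) spends exactly \<open>n - 1\<close> of the \<open>n\<close> available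
  powers of each \<open>s\<^sup>2 + y\<^sub>j\<^sup>2\<close>, and leaves the integrable product \<open>\<Prod>\<^sub>j 1 / (s\<^sup>2 + y\<^sub>j\<^sup>2)\<close>
  (\<open>cauchy_weight_bound\<close>). The limiting normalisation is not zero because \<open>W\<close> is positive on the
  nonempty open set \<open>D\<close>.

  Only the proportionality of the Cauchy determinant to \<open>W\<close> matters, not the constant. It comes from the
  matrices \<open>p\<^sub>i(b\<^sub>j)\<close> with \<open>p\<^sub>i\<close> of degree less than \<open>n\<close>: as a function of a single \<open>b\<^sub>k\<close>, their determinant
  and the Vandermonde product are polynomials of degree less than \<open>n\<close> with the same \<open>n - 1\<close> roots, hence
  proportional. Moving the nodes one at a time (\<open>det_eval_vandermonde\<close>) compares an arbitrary \<open>b\<close> with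
  \<open>b = -a\<close>, where for \<open>p\<^sub>i(z) = \<Prod>\<^sub>k\<^sub>\<noteq>\<^sub>i (a\<^sub>k + z)\<close> the matrix is diagonal and visibly invertible. This avoids any
  induction on the dimension, which here is a type.
\<close>

section \<open>Determinants of polynomials evaluated at nodes\<close>

definition vandermonde :: "('n::{finite,linorder} \<Rightarrow> 'a::comm_ring_1) \<Rightarrow> 'a" where
  "vandermonde b = (\<Prod>(i, j)\<in>{(i, j). i < j}. b i - b j)"

lemma vandermonde_eq_0_iff:
  fixes b :: "'n::{finite,linorder} \<Rightarrow> 'a::idom"
  shows "vandermonde b = 0 \<longleftrightarrow> \<not> inj b"
proof
  assume "\<not> inj b"
  then obtain i j where "b i = b j" "i \<noteq> j" by (auto simp: inj_def)
  then have "\<exists>i j. i < j \<and> b i = b j"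
    by (metis neq_iff)
  then show "vandermonde b = 0"
    by (auto simp: vandermonde_def)
qed (auto simp: vandermonde_def inj_def)

lemma vandermonde_fun_upd:
  fixes b :: "'n::{finite,linorder} \<Rightarrow> 'a::comm_ring_1"
  shows "\<exists>c. \<forall>z. vandermonde (b(k := z)) = c * (\<Prod>j\<in>-{k}. z - b j)"
proof -
  \<comment> \<open>The pairs are split by whether \<open>k\<close> is the smaller index, the larger index, or absent; the second
    group has its differences reversed, which costs a sign that does not depend on \<open>z\<close>.\<close>
  let ?f = "\<lambda>z (i, j). (b(k := z)) i - (b(k := z)) j"
  let ?A = "Pair k ` {k<..}" and ?B = "(\<lambda>i. (i, k)) ` {..<k}"
    and ?C = "{(i, j). i < j \<and> i \<noteq> k \<and> j \<noteq> k}"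
  have split: "{(i, j). i < j} = (?A \<union> ?B) \<union> ?C" by auto
  have compl: "-{k} = {k<..} \<union> {..<k}" by auto
  have "vandermonde (b(k := z)) =
      ((-1) ^ card {..<k} * (\<Prod>(i, j)\<in>?C. b i - b j)) * (\<Prod>j\<in>-{k}. z - b j)" for z
  proof -
    have A: "prod (?f z) ?A = (\<Prod>j\<in>{k<..}. z - b j)"
      by (subst prod.reindex) (auto simp: inj_on_def intro!: prod.cong)
    have "prod (?f z) ?B = (\<Prod>i\<in>{..<k}. (-1) * (z - b i))"
      by (subst prod.reindex) (auto simp: inj_on_def intro!: prod.cong)
    also have "\<dots> = (-1) ^ card {..<k} * (\<Prod>i\<in>{..<k}. z - b i)"
      by (simp only: prod.distrib prod_constant)
    finally have B: "prod (?f z) ?B = (-1) ^ card {..<k} * (\<Prod>i\<in>{..<k}. z - b i)" .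
    have C: "prod (?f z) ?C = (\<Prod>(i, j)\<in>?C. b i - b j)"
      by (rule prod.cong) auto
    have "vandermonde (b(k := z)) = prod (?f z) ?A * prod (?f z) ?B * prod (?f z) ?C"
      unfolding vandermonde_def split
      by (subst prod.union_disjoint, (auto intro: finite_subset[of _ UNIV])[3],
          subst prod.union_disjoint) auto
    moreover have "(\<Prod>j\<in>-{k}. z - b j) = (\<Prod>j\<in>{k<..}. z - b j) * (\<Prod>j\<in>{..<k}. z - b j)"
      unfolding compl by (subst prod.union_disjoint) auto
    ultimately show ?thesis
      unfolding A B C by (simp add: mult_ac)
  qed
  then show ?thesis by blast
qed

text \<open>
  Linearity of the determinant in row \<open>k\<close> makes it a linear combination of the \<open>p i\<close>, whose coefficients
  are the cofactors of that row.
\<close>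

lemma det_eval_row_poly:
  fixes p :: "'n::{finite,linorder} \<Rightarrow> 'a::idom poly"
  assumes deg: "\<And>i. degree (p i) < CARD('n)"
  shows "\<exists>q. degree q < CARD('n) \<and> (\<forall>z. det (\<chi> j i. poly (p i) ((b(k := z)) j)) = poly q z)"
proof -
  define d where "d i = det (\<chi> j. if j = k then axis i 1 else (\<chi> i. poly (p i) (b j)))" for i
  have "det (\<chi> j i. poly (p i) ((b(k := z)) j)) = poly (\<Sum>i\<in>UNIV. smult (d i) (p i)) z" for z
  proof -
    have "(\<chi> j i. poly (p i) ((b(k := z)) j)) =
        (\<chi> j. if j = k then (\<Sum>i\<in>UNIV. poly (p i) z *s axis i 1) else (\<chi> i. poly (p i) (b j)))"
      by (simp add: vec_eq_iff axis_def if_distrib[of "(*) _"] cong: if_cong)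
    then show ?thesis
      by (simp add: det_linear_row_sum[of UNIV k "\<lambda>_ i. poly (p i) z *s axis i 1"] det_row_mul
          d_def poly_sum mult.commute)
  qed
  moreover have "degree (\<Sum>i\<in>UNIV. smult (d i) (p i)) < CARD('n)"
    by (rule degree_sum_less) (auto intro: deg)
  ultimately show ?thesis by blast
qed

text \<open>
  Both the determinant and the Vandermonde product vanish when \<open>z\<close> meets one of the \<open>n - 1\<close> other nodes.
  Cross-multiplied with their values at \<open>w\<close>, the two polynomials in \<open>z\<close> agree at \<open>w\<close> as well, that is at
  \<open>n\<close> points, while their degrees are less than \<open>n\<close>.
\<close>

lemma det_eval_fun_upd_vandermonde:
  fixes p :: "'n::{finite,linorder} \<Rightarrow> 'a::idom poly"
  assumes deg: "\<And>i. degree (p i) < CARD('n)"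
  assumes inj: "inj (b(k := w))"
  shows "det (\<chi> j i. poly (p i) ((b(k := z)) j)) * vandermonde (b(k := w)) =
         det (\<chi> j i. poly (p i) ((b(k := w)) j)) * vandermonde (b(k := z))"
proof -
  obtain q where q: "degree q < CARD('n)"
      "\<And>z. det (\<chi> j i. poly (p i) ((b(k := z)) j)) = poly q z"
    using det_eval_row_poly[where p = p and b = b and k = k, OF deg] by blast
  obtain c where c: "\<And>z. vandermonde (b(k := z)) = c * (\<Prod>j\<in>-{k}. z - b j)"
    using vandermonde_fun_upd[where b = b and k = k] by blast
  define r where "r = (\<Prod>j\<in>-{k}. [:- b j, 1:])"
  have r: "poly r z = (\<Prod>j\<in>-{k}. z - b j)" for z
    by (simp add: r_def poly_prod)
  have "degree r = CARD('n) - 1"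
    unfolding r_def by (subst degree_prod_sum_eq) (auto simp: card_Diff_singleton Compl_eq_Diff_UNIV)
  then have degr: "degree r < CARD('n)" by simp
  have root: "poly q (b j) = 0" if "j \<noteq> k" for j
    unfolding q(2)[symmetric]
    by (rule det_identical_rows[OF that]) (use that in \<open>simp add: row_def vec_eq_iff\<close>)
  have card: "card (range (b(k := w))) = CARD('n)"
    using inj by (rule card_image)
  have "smult (poly r w) q = smult (poly q w) r"
  proof (rule poly_eqI_degree)
    show "poly (smult (poly r w) q) x = poly (smult (poly q w) r) x" if "x \<in> range (b(k := w))" for x
      using that by (auto simp: root r split: if_splits)
    show "degree (smult (poly r w) q) < card (range (b(k := w)))"
         "degree (smult (poly q w) r) < card (range (b(k := w)))"
      unfolding card by (rule le_less_trans[OF degree_smult_le q(1)],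
        rule le_less_trans[OF degree_smult_le degr])
  qed
  then have "poly r w * poly q z = poly q w * poly r z"
    by (metis poly_smult)
  then show ?thesis
    by (simp only: q(2) c r mult.left_commute)
       (simp add: mult_ac)
qed

text \<open>
  The nodes \<open>c\<close> are replaced by \<open>b\<close> one index at a time. With injectivity, disjointness of the ranges keeps the nodes of every
  intermediate stage distinct, so that the intermediate Vandermonde products can be cancelled.
\<close>

lemma det_eval_vandermonde:
  fixes p :: "'n::{finite,linorder} \<Rightarrow> 'a::idom poly"
  assumes deg: "\<And>i. degree (p i) < CARD('n)"
  assumes inj: "inj b" "inj c" and disj: "range b \<inter> range c = {}"
  shows "det (\<chi> j i. poly (p i) (b j)) * vandermonde c =
         det (\<chi> j i. poly (p i) (c j)) * vandermonde b"
proof -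
  define e where "e S j = (if j \<in> S then b j else c j)" for S j
  have inj_e: "inj (e S)" for S
    using inj disj unfolding inj_def e_def by (metis IntI emptyE rangeI)
  have "det (\<chi> j i. poly (p i) (e S j)) * vandermonde c =
        det (\<chi> j i. poly (p i) (c j)) * vandermonde (e S)" if "finite S" for S
    using that
  proof induction
    case empty
    then show ?case by (simp add: e_def)
  next
    case (insert k S)
    let ?f = "\<lambda>b. det (\<chi> j i. poly (p i) (b j))"
    have e: "(e S)(k := b k) = e (insert k S)" "(e S)(k := c k) = e S"
      using insert.hyps by (auto simp: e_def fun_eq_iff)
    have "?f (e (insert k S)) * vandermonde (e S) = ?f (e S) * vandermonde (e (insert k S))"
      using det_eval_fun_upd_vandermonde[where p = p and b = "e S" and k = k and w = "c k" and z = "b k",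
          OF deg] inj_e
      by (simp only: e)
    then have "vandermonde (e S) * (?f (e (insert k S)) * vandermonde c) =
        vandermonde (e S) * (?f c * vandermonde (e (insert k S)))"
      using insert.IH by (metis (no_types, lifting) mult.commute mult.left_commute)
    then show ?case
      using inj_e by (simp add: vandermonde_eq_0_iff)
  qed
  from this[of UNIV] show ?thesis unfolding e_def by simp
qed

lemma det_columns_mul:
  fixes a :: "'n::finite \<Rightarrow> 'n \<Rightarrow> 'a::comm_ring_1"
  shows "det (\<chi> i j. c j * a i j) = prod c UNIV * det (\<chi> i j. a i j)"
proof -
  have "det (\<chi> i j. c j * a i j) = det (\<chi> j. c j *s (\<chi> i. a i j))"
    by (subst det_transpose[symmetric]) (simp add: transpose_def vector_scalar_mult_def)
  also have "\<dots> = prod c UNIV * det (\<chi> j i. a i j)"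
    by (simp add: det_rows_mul)
  also have "det (\<chi> j i. a i j) = det (\<chi> i j. a i j)"
    by (subst det_transpose[symmetric]) (simp add: transpose_def)
  finally show ?thesis .
qed

section \<open>The Cauchy determinant\<close>

text \<open>
  Multiplying column \<open>j\<close> of the Cauchy matrix by \<open>\<Prod>\<^sub>i (a\<^sub>i + b\<^sub>j)\<close> turns its entries into values at \<open>b\<^sub>j\<close> of the
  polynomials \<open>\<Prod>\<^sub>k\<^sub>\<noteq>\<^sub>i (a\<^sub>k + z)\<close>. The nodes \<open>-a\<close> serve as the reference point that fixes the constant: the
  hypothesis \<open>a\<^sub>i + b\<^sub>j \<noteq> 0\<close> says that they are disjoint from \<open>b\<close>.
\<close>

lemma cauchy_det_proportional:
  fixes a :: "'n::{finite,linorder} \<Rightarrow> 'a::field"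
  assumes inj_a: "inj a"
  obtains K where "K \<noteq> 0"
    and "\<And>b. inj b \<Longrightarrow> (\<And>i j. a i + b j \<noteq> 0) \<Longrightarrow>
      det (\<chi> i j. 1 / (a i + b j)) = K * ((\<Prod>j\<in>UNIV. inverse (\<Prod>i\<in>UNIV. a i + b j)) * vandermonde b)"
proof -
  define p where "p i = (\<Prod>k\<in>-{i}. [:a k, 1:])" for i
  have p: "poly (p i) z = (\<Prod>k\<in>-{i}. a k + z)" for i z
    by (simp add: p_def poly_prod)
  have "degree (p i) = CARD('n) - 1" for i
    unfolding p_def by (subst degree_prod_sum_eq) (auto simp: card_Diff_singleton Compl_eq_Diff_UNIV)
  then have deg: "degree (p i) < CARD('n)" for i by simp
  let ?c = "\<lambda>j. - a j"
  have "det (\<chi> j i. poly (p i) (?c j)) = (\<Prod>i\<in>UNIV. poly (p i) (?c i))"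
    by (subst det_diagonal) (auto simp: p)
  also have "\<dots> \<noteq> 0"
    using inj_a by (auto simp: p inj_def)
  finally have c0: "det (\<chi> j i. poly (p i) (?c j)) \<noteq> 0" .
  have inj_c: "inj ?c" using inj_a by (simp add: inj_def)
  then have Vc: "vandermonde ?c \<noteq> 0" by (simp add: vandermonde_eq_0_iff)
  define K where "K = det (\<chi> j i. poly (p i) (?c j)) / vandermonde ?c"
  show ?thesis
  proof (rule that)
    show "K \<noteq> 0" using c0 Vc by (simp add: K_def)
    fix b :: "'n \<Rightarrow> 'a"
    assume inj_b: "inj b" and nz: "\<And>i j. a i + b j \<noteq> 0"
    have disj: "range b \<inter> range ?c = {}"
      using nz by (force simp: eq_neg_iff_add_eq_0 add.commute)
    have "1 / (a i + b j) = inverse (\<Prod>k\<in>UNIV. a k + b j) * poly (p i) (b j)" for i j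
    proof -
      have "(\<Prod>k\<in>UNIV. a k + b j) = (a i + b j) * (\<Prod>k\<in>-{i}. a k + b j)"
        by (subst prod.remove[of UNIV i]) (auto simp: Compl_eq_Diff_UNIV)
      moreover have "(\<Prod>k\<in>-{i}. a k + b j) \<noteq> 0"
        using nz by simp
      ultimately show ?thesis
        by (simp add: p inverse_eq_divide)
    qed
    then have "det (\<chi> i j. 1 / (a i + b j)) =
        (\<Prod>j\<in>UNIV. inverse (\<Prod>i\<in>UNIV. a i + b j)) * det (\<chi> i j. poly (p i) (b j))"
      by (simp only: det_columns_mul)
    also have "det (\<chi> i j. poly (p i) (b j)) = det (\<chi> j i. poly (p i) (b j))"
      by (subst det_transpose[symmetric]) (simp add: transpose_def)
    also have "\<dots> = K * vandermonde b"
      using det_eval_vandermonde[OF deg inj_b inj_c disj] Vc by (simp add: K_def field_simps)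
    finally show "det (\<chi> i j. 1 / (a i + b j)) =
        K * ((\<Prod>j\<in>UNIV. inverse (\<Prod>i\<in>UNIV. a i + b j)) * vandermonde b)"
      by (simp add: mult_ac)
  qed
qed


section \<open>The normalised density\<close>

lemma open_D: "open (D :: (real ^ 'n::{finite,linorder}) set)"
proof -
  have "D = (\<Inter>i. {x :: (real, 'n) vec. 0 < x $ i}) \<inter> (\<Inter>(i, j)\<in>{(i, j). i < j}. {x. x $ j < x $ i})"
    by (auto simp: D_def)
  also have "open \<dots>"
    by (intro open_Int open_INT finite ballI)
       (auto split: prod.splits intro!: open_Collect_less continuous_intros)
  finally show ?thesis .
qed

lemma inj_D_squares:
  assumes "x \<in> D" shows "inj (\<lambda>i. (x $ i)\<^sup>2)"
proof (rule injI, rule ccontr)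
  fix i j assume eq: "(x $ i)\<^sup>2 = (x $ j)\<^sup>2" and "i \<noteq> j"
  have "x $ i = x $ j"
    using eq assms by (auto simp: D_def power2_eq_iff_nonneg less_imp_le)
  then show False
    using assms \<open>i \<noteq> j\<close> by (metis (mono_tags, lifting) D_def mem_Collect_eq neq_iff)
qed

text \<open>
  The factor of the Cauchy determinant with nodes \<open>x\<^sub>i\<^sup>2\<close> and \<open>y\<^sub>j\<^sup>2\<close> that depends on \<open>y\<close>. Unlike the
  determinant itself it does not vanish when the coordinates of \<open>x\<close> coincide.
\<close>

definition cauchy_weight :: "real ^ 'n::{finite,linorder} \<Rightarrow> real ^ 'n::{finite,linorder} \<Rightarrow> real" where
  "cauchy_weight x y =
     (\<Prod>j\<in>UNIV. inverse (\<Prod>i\<in>UNIV. (x $ i)\<^sup>2 + (y $ j)\<^sup>2)) * vandermonde (\<lambda>j. (y $ j)\<^sup>2)"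

lemma H_proportional_cauchy_weight:
  fixes x :: "real ^ 'n::{finite,linorder}"
  assumes x: "x \<in> D"
  obtains K where "K \<noteq> 0" and "\<And>y. y \<in> D \<Longrightarrow> H x y = K * cauchy_weight x y"
proof -
  obtain K where K: "K \<noteq> 0"
    and det: "\<And>b. inj b \<Longrightarrow> (\<And>i j. (x $ i)\<^sup>2 + b j \<noteq> 0) \<Longrightarrow>
      det (\<chi> i j. 1 / ((x $ i)\<^sup>2 + b j)) =
      K * ((\<Prod>j\<in>UNIV. inverse (\<Prod>i\<in>UNIV. (x $ i)\<^sup>2 + b j)) * vandermonde b)"
    using cauchy_det_proportional[OF inj_D_squares[OF x]] by blast
  have pos: "0 < x $ i" for i using x by (simp add: D_def)
  show ?thesis
  proof (rule that)
    show "(\<Prod>i\<in>UNIV. 2 / pi * x $ i) * K \<noteq> 0"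
      using K pos by (simp add: less_imp_neq[symmetric])
    fix y :: "(real, 'n) vec" assume y: "y \<in> D"
    have "H x y = det (\<chi> i. (2 / pi * x $ i) *s (\<chi> j. 1 / ((x $ i)\<^sup>2 + (y $ j)\<^sup>2)))"
      unfolding H_def by (rule arg_cong[of _ _ det]) (simp add: h_def vec_eq_iff)
    also have "\<dots> = (\<Prod>i\<in>UNIV. 2 / pi * x $ i) * (K * cauchy_weight x y)"
      using pos unfolding cauchy_weight_def
      by (subst det_rows_mul, subst det[OF inj_D_squares[OF y]])
         (auto simp: sum_power2_eq_zero_iff less_imp_neq[symmetric])
    finally show "H x y = (\<Prod>i\<in>UNIV. 2 / pi * x $ i) * K * cauchy_weight x y" by simp
  qed
qed

text \<open>
  The constant depends on \<open>x\<close> only, so it comes out of the integral and cancels.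
\<close>

lemma H_tilde_eq_cauchy_weight:
  assumes x: "x \<in> D" and y: "y \<in> D"
  shows "H_tilde x y = cauchy_weight x y / (LINT y':D|lborel. cauchy_weight x y')"
proof -
  obtain K where K: "K \<noteq> 0" "\<And>y. y \<in> D \<Longrightarrow> H x y = K * cauchy_weight x y"
    using H_proportional_cauchy_weight[OF x] by blast
  have "(LINT y':D|lborel. H x y') = (LINT y':D|lborel. K * cauchy_weight x y')"
    by (rule set_lebesgue_integral_cong) (use K in \<open>auto intro!: borel_open open_D\<close>)
  then show ?thesis
    using K y by (simp add: H_tilde_def field_simps)
qed

lemma limit_weight_eq_cauchy_weight: "limit_weight t y = cauchy_weight (\<chi> i. t) y"
  by (simp add: limit_weight_def cauchy_weight_def vandermonde_def power_int_minus)

lemma cauchy_weight_pos: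
  assumes "\<And>i. 0 < x $ i" and y: "y \<in> D"
  shows "0 < cauchy_weight x y"
proof -
  have "(y $ j)\<^sup>2 < (y $ i)\<^sup>2" if "i < j" for i j
    using y that by (auto simp: D_def intro!: power_strict_mono less_imp_le)
  then show ?thesis
    using assms(1) unfolding cauchy_weight_def vandermonde_def
    by (intro mult_pos_pos prod_pos) (auto intro!: prod_pos add_pos_nonneg simp: less_imp_neq[symmetric])
qed

lemma isCont_cauchy_weight:
  assumes "\<And>i. 0 < x $ i"
  shows "isCont (\<lambda>x. cauchy_weight x y) x" and "isCont (cauchy_weight x) y"
proof -
  have "(x $ i)\<^sup>2 + (y $ j)\<^sup>2 \<noteq> 0" for i j
    using assms[of i] by (simp add: sum_power2_eq_zero_iff)
  then show "isCont (\<lambda>x. cauchy_weight x y) x" "isCont (cauchy_weight x) y"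
    unfolding cauchy_weight_def vandermonde_def case_prod_beta
    by (auto intro!: continuous_intros)
qed

section \<open>An integrable bound\<close>

text \<open>
  Each index \<open>i\<close> occurs in exactly \<open>n - 1\<close> of the pairs, as smaller or as larger member.
\<close>

lemma prod_less_pairs_mult:
  fixes u :: "'n::{finite,linorder} \<Rightarrow> 'a::comm_monoid_mult"
  shows "(\<Prod>(i, j)\<in>{(i, j). i < j}. u i * u j) = (\<Prod>i\<in>UNIV. u i ^ (CARD('n) - 1))"
proof -
  let ?P = "{(i, j). i < j} :: ('n \<times> 'n) set"
  have P1: "?P = Sigma UNIV (\<lambda>i. {i<..})" by auto
  have P2: "?P = prod.swap ` Sigma UNIV (\<lambda>j. {..<j})" by auto
  have "(\<Prod>(i, j)\<in>?P. u i * u j) = (\<Prod>(i, j)\<in>?P. u i) * (\<Prod>(i, j)\<in>?P. u j)"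
    by (simp add: case_prod_beta prod.distrib)
  also have "(\<Prod>(i, j)\<in>?P. u i) = (\<Prod>i\<in>UNIV. u i ^ card {i<..})"
    unfolding P1 by (subst prod.Sigma[symmetric]) auto
  also have "(\<Prod>(i, j)\<in>?P. u j) = (\<Prod>j\<in>UNIV. u j ^ card {..<j})"
    unfolding P2
    by (subst prod.reindex)
       (auto simp: case_prod_beta o_def prod.Sigma[symmetric, where g = "\<lambda>j i. u j", unfolded case_prod_beta])
  also have "(\<Prod>i\<in>UNIV. u i ^ card {i<..}) * \<dots> = (\<Prod>i\<in>UNIV. u i ^ (card {i<..} + card {..<i}))"
    by (simp add: prod.distrib power_add)
  also have "(\<lambda>i :: 'n. card {i<..} + card {..<i}) = (\<lambda>_. CARD('n) - 1)"
  proof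
    fix i :: 'n
    have "card {i<..} + card {..<i} = card ({i<..} \<union> {..<i})"
      by (subst card_Un_disjoint) auto
    also have "{i<..} \<union> {..<i} = UNIV - {i}" by auto
    finally show "card {i<..} + card {..<i} = CARD('n) - 1" by simp
  qed
  finally show ?thesis .
qed

text \<open>
  Each factor of the Vandermonde product is bounded by
  \<open>\<bar>y\<^sub>i\<^sup>2 - y\<^sub>j\<^sup>2\<bar> \<le> (s\<^sup>2 + y\<^sub>i\<^sup>2) (s\<^sup>2 + y\<^sub>j\<^sup>2) / s\<^sup>2\<close>. By the preceding count the product over all pairs uses up
  \<open>n - 1\<close> of the \<open>n\<close> powers of \<open>s\<^sup>2 + y\<^sub>j\<^sup>2\<close> in the denominator. The bound is uniform in \<open>x\<close>, as
  dominated convergence demands.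
\<close>

lemma cauchy_weight_bound:
  fixes y :: "real ^ 'n::{finite,linorder}"
  assumes s: "0 < s" and x: "\<And>i. s \<le> x $ i"
  shows "\<bar>cauchy_weight x y\<bar> \<le>
    (1 / s\<^sup>2) ^ card {(i :: 'n, j). i < j} * (\<Prod>j\<in>UNIV. 1 / (s\<^sup>2 + (y $ j)\<^sup>2))"
proof -
  define u where "u j = s\<^sup>2 + (y $ j)\<^sup>2" for j
  have u: "0 < u j" for j using s by (simp add: u_def add_pos_nonneg)
  have "\<bar>\<Prod>j\<in>UNIV. inverse (\<Prod>i\<in>UNIV. (x $ i)\<^sup>2 + (y $ j)\<^sup>2)\<bar> \<le> (\<Prod>j\<in>UNIV. inverse (u j ^ CARD('n)))"
  proof -
    have "u j ^ CARD('n) \<le> (\<Prod>i\<in>UNIV. (x $ i)\<^sup>2 + (y $ j)\<^sup>2)" for j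
    proof -
      have "(\<Prod>i\<in>(UNIV::'n set). u j) \<le> (\<Prod>i\<in>UNIV. (x $ i)\<^sup>2 + (y $ j)\<^sup>2)"
        using u s x by (intro prod_mono) (auto simp: u_def less_imp_le intro!: power_mono)
      then show ?thesis by simp
    qed
    then show ?thesis
      unfolding abs_prod using u
      by (intro prod_mono) (auto simp: abs_inverse abs_prod prod_nonneg intro!: le_imp_inverse_le)
  qed
  moreover have "\<bar>vandermonde (\<lambda>j. (y $ j)\<^sup>2)\<bar> \<le>
      (1 / s\<^sup>2) ^ card {(i :: 'n, j). i < j} * (\<Prod>j\<in>UNIV. u j ^ (CARD('n) - 1))"
  proof -
    have "\<bar>(y $ i)\<^sup>2 - (y $ j)\<^sup>2\<bar> \<le> 1 / s\<^sup>2 * (u i * u j)" for i j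
    proof -
      have "s\<^sup>2 * \<bar>(y $ i)\<^sup>2 - (y $ j)\<^sup>2\<bar> \<le> s\<^sup>2 * ((y $ i)\<^sup>2 + (y $ j)\<^sup>2)"
        by (intro mult_left_mono) (auto simp: abs_le_iff)
      also have "\<dots> \<le> u i * u j"
        by (simp add: u_def algebra_simps)
      finally show ?thesis using s by (simp add: field_simps)
    qed
    then have "\<bar>vandermonde (\<lambda>j. (y $ j)\<^sup>2)\<bar> \<le> (\<Prod>(i, j)\<in>{(i, j). i < j}. 1 / s\<^sup>2 * (u i * u j))"
      unfolding vandermonde_def abs_prod by (intro prod_mono) auto
    also have "\<dots> = (1 / s\<^sup>2) ^ card {(i :: 'n, j). i < j} * (\<Prod>j\<in>UNIV. u j ^ (CARD('n) - 1))"
      unfolding prod_less_pairs_mult[symmetric]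
      by (subst prod_constant[symmetric], subst prod.distrib[symmetric]) (auto intro!: prod.cong)
    finally show ?thesis .
  qed
  ultimately have "\<bar>cauchy_weight x y\<bar> \<le> (\<Prod>j\<in>UNIV. inverse (u j ^ CARD('n))) *
      ((1 / s\<^sup>2) ^ card {(i :: 'n, j). i < j} * (\<Prod>j\<in>UNIV. u j ^ (CARD('n) - 1)))"
    unfolding cauchy_weight_def abs_mult using u by (intro mult_mono) (auto intro!: prod_nonneg less_imp_le)
  also have "\<dots> = (1 / s\<^sup>2) ^ card {(i :: 'n, j). i < j} *
      (\<Prod>j\<in>UNIV. inverse (u j ^ CARD('n)) * u j ^ (CARD('n) - 1))"
    by (simp add: prod.distrib)
  also have "(\<Prod>j\<in>UNIV. inverse (u j ^ CARD('n)) * u j ^ (CARD('n) - 1)) = (\<Prod>j\<in>UNIV. 1 / u j)"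
  proof (rule prod.cong)
    fix j
    have "u j ^ CARD('n) = u j * u j ^ (CARD('n) - 1)"
      by (simp add: power_eq_if)
    then show "inverse (u j ^ CARD('n)) * u j ^ (CARD('n) - 1) = 1 / u j"
      using u[of j] by (simp add: field_simps)
  qed simp
  finally show ?thesis by (simp add: u_def)
qed

text \<open>
  Lebesgue measure on the vectors is by construction the image of the product measure over the standard
  basis, so this is Fubini's theorem after reindexing by the unit vectors.
\<close>

lemma integrable_prod_vec:
  fixes f :: "real \<Rightarrow> real"
  assumes f: "integrable lborel f"
  shows "integrable lborel (\<lambda>y :: real ^ 'n::finite. \<Prod>j\<in>UNIV. f (y $ j))"
proof -
  interpret product_sigma_finite "\<lambda>b :: (real, 'n) vec. lborel :: real measure" ..
  have [measurable]: "f \<in> borel_measurable borel"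
    using borel_measurable_integrable[OF f] by simp
  have reindex: "(\<Prod>j\<in>UNIV. f (y $ j)) = (\<Prod>b\<in>Basis. f (y \<bullet> b))" for y :: "(real, 'n) vec"
  proof -
    have "Basis = range (\<lambda>j. axis j 1 :: (real, 'n) vec)" by (auto simp: Basis_vec_def)
    then have "(\<Prod>b\<in>Basis. f (y \<bullet> b)) = (\<Prod>b\<in>range (\<lambda>j. axis j 1). f (y \<bullet> b))"
      by simp
    also have "\<dots> = (\<Prod>j\<in>UNIV. f (y $ j))"
      by (subst prod.reindex) (auto simp: inj_on_def axis_eq_axis cart_eq_inner_axis)
    finally show ?thesis ..
  qed
  have "integrable (\<Pi>\<^sub>M b\<in>(Basis :: (real, 'n) vec set). lborel) (\<lambda>y. \<Prod>b\<in>Basis. f (y b))"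
    by (rule product_integrable_prod) (use f in auto)
  then show ?thesis
    unfolding reindex
    by (subst lborel_eq, subst integrable_distr_eq)
       (auto simp: inner_sum_left inner_Basis if_distrib cong: if_cong)
qed

text \<open>
  The substitution \<open>y = s z\<close> reduces the claim to the derivative of the arctangent.
\<close>

lemma integrable_inverse_square_plus:
  assumes "0 < s"
  shows "integrable lborel (\<lambda>y :: real. 1 / (s\<^sup>2 + y\<^sup>2))"
proof -
  have "integrable lborel (\<lambda>y :: real. inverse (1 + y\<^sup>2))"
    using integrable_inverse_1_plus_square by (simp add: set_integrable_def)
  then have "integrable lborel (\<lambda>y :: real. 1 / s\<^sup>2 * inverse (1 + (0 + 1 / s * y)\<^sup>2))"
    using assms by (intro integrable_mult_right lborel_integrable_real_affine) auto
  moreover have "1 / s\<^sup>2 * inverse (1 + (0 + 1 / s * y)\<^sup>2) = 1 / (s\<^sup>2 + y\<^sup>2)" for y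
    using assms by (simp add: field_simps power2_eq_square)
  ultimately show ?thesis by simp
qed

lemma integrable_cauchy_weight_bound:
  assumes "0 < s"
  shows "integrable lborel (\<lambda>y :: real ^ 'n::finite. c * (\<Prod>j\<in>UNIV. 1 / (s\<^sup>2 + (y $ j)\<^sup>2)))"
  by (intro integrable_mult_right integrable_prod_vec integrable_inverse_square_plus assms)

lemma borel_measurable_cauchy_weight:
  assumes "\<And>i. 0 < x $ i"
  shows "(\<lambda>y. indicator D y *\<^sub>R cauchy_weight x y) \<in> borel_measurable lborel"
proof -
  have "cauchy_weight x \<in> borel_measurable borel"
    using isCont_cauchy_weight(2)[OF assms]
    by (intro borel_measurable_continuous_onI) (simp add: continuous_on_eq_continuous_at)
  then show ?thesis
    by (intro borel_measurable_scaleR borel_measurable_indicator) (simp_all add: borel_open open_D)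
qed

lemma set_integrable_cauchy_weight:
  fixes x :: "real ^ 'n::{finite,linorder}"
  assumes s: "0 < s" and x: "\<And>i. s \<le> x $ i"
  shows "set_integrable lborel D (cauchy_weight x)"
  unfolding set_integrable_def
proof (rule Bochner_Integration.integrable_bound)
  show "integrable lborel (\<lambda>y :: (real, 'n) vec.
      (1 / s\<^sup>2) ^ card {(i :: 'n, j). i < j} * (\<Prod>j\<in>UNIV. 1 / (s\<^sup>2 + (y $ j)\<^sup>2)))"
    by (rule integrable_cauchy_weight_bound[OF s])
  show "(\<lambda>y. indicator D y *\<^sub>R cauchy_weight x y) \<in> borel_measurable lborel"
    using s x by (intro borel_measurable_cauchy_weight) (metis less_le_trans)
  show "AE y in lborel. norm (indicator D y *\<^sub>R cauchy_weight x y) \<le>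
      norm ((1 / s\<^sup>2) ^ card {(i :: 'n, j). i < j} * (\<Prod>j\<in>UNIV. 1 / (s\<^sup>2 + (y $ j)\<^sup>2)))"
    using order_trans[OF cauchy_weight_bound[OF s x] abs_ge_self]
    by (intro AE_I2) (auto simp: indicator_def)
qed

section \<open>Continuity of the normalisation and the limit\<close>

lemma tendsto_integral_cauchy_weight:
  fixes x0 :: "real ^ 'n::{finite,linorder}"
  assumes x0: "\<And>i. 0 < x0 $ i"
  shows "((\<lambda>x. LINT y:D|lborel. cauchy_weight x y) \<longlongrightarrow> (LINT y:D|lborel. cauchy_weight x0 y))
           (at x0 within A)"
proof -
  \<comment> \<open>Half the least coordinate of \<open>x0\<close>: all \<open>x\<close> near \<open>x0\<close> have coordinates above \<open>s\<close>, so one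
    dominating function serves for the whole neighbourhood \<open>?U\<close>.\<close>
  define s where "s = Min (range (($) x0)) / 2"
  have s0: "0 < s" using x0 by (simp add: s_def)
  have sx0: "s < x0 $ i" for i
  proof -
    have "Min (range (($) x0)) \<le> x0 $ i" by (rule Min_le) auto
    then show ?thesis using s0 unfolding s_def by linarith
  qed
  let ?U = "{x :: (real, 'n) vec. \<forall>i. s < x $ i}"
  have "?U = (\<Inter>i. {x :: (real, 'n) vec. s < x $ i})" by auto
  also have "open \<dots>"
    by (intro open_INT finite ballI open_Collect_less continuous_intros)
  finally have "open ?U" .
  then have at: "at x0 within A = at x0 within (A \<inter> ?U)"
    using sx0 by (intro at_within_nhd[of x0 ?U]) auto
  show ?thesis
    unfolding at tendsto_at_iff_sequentially o_def set_lebesgue_integral_def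
  proof (intro allI impI)
    fix X assume X: "\<forall>i. X i \<in> A \<inter> ?U - {x0}" "X \<longlonglongrightarrow> x0"
    have Xs: "s \<le> X n $ i" "0 < X n $ i" for n i
      using X(1) s0 by (auto intro: less_imp_le less_trans)
    show "(\<lambda>n. LINT y|lborel. indicator D y *\<^sub>R cauchy_weight (X n) y) \<longlonglongrightarrow>
          (LINT y|lborel. indicator D y *\<^sub>R cauchy_weight x0 y)"
    proof (rule integral_dominated_convergence)
      show "integrable lborel (\<lambda>y :: (real, 'n) vec.
          (1 / s\<^sup>2) ^ card {(i :: 'n, j). i < j} * (\<Prod>j\<in>UNIV. 1 / (s\<^sup>2 + (y $ j)\<^sup>2)))"
        by (rule integrable_cauchy_weight_bound[OF s0])
      show "AE y in lborel. norm (indicator D y *\<^sub>R cauchy_weight (X n) y) \<le>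
          (1 / s\<^sup>2) ^ card {(i :: 'n, j). i < j} * (\<Prod>j\<in>UNIV. 1 / (s\<^sup>2 + (y $ j)\<^sup>2))" for n
        using cauchy_weight_bound[OF s0 Xs(1)] order_trans[OF abs_ge_zero cauchy_weight_bound[OF s0 Xs(1)]]
        by (intro AE_I2) (auto simp: indicator_def)
      show "AE y in lborel. (\<lambda>n. indicator D y *\<^sub>R cauchy_weight (X n) y) \<longlonglongrightarrow>
          indicator D y *\<^sub>R cauchy_weight x0 y"
        by (intro AE_I2 tendsto_scaleR tendsto_const
            isCont_tendsto_compose[OF isCont_cauchy_weight(1)[OF x0] X(2)])
    qed (use borel_measurable_cauchy_weight x0 Xs(2) in auto)
  qed
qed

text \<open>
  The integrand is positive on \<open>D\<close>, so a vanishing integral would make the nonempty open set \<open>D\<close> a null set.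
\<close>

lemma integral_cauchy_weight_nonzero:
  fixes x :: "real ^ 'n::{finite,linorder}"
  assumes s: "0 < s" and x: "\<And>i. s \<le> x $ i" and ne: "(D :: (real ^ 'n::{finite,linorder}) set) \<noteq> {}"
  shows "(LINT y:D|lborel. cauchy_weight x y) \<noteq> 0"
proof
  assume "(LINT y:D|lborel. cauchy_weight x y) = 0"
  have x0: "0 < x $ i" for i using s x[of i] by simp
  have "AE y in lborel. indicator D y *\<^sub>R cauchy_weight x y = 0"
    using \<open>_ = 0\<close> set_integrable_cauchy_weight[OF s x] cauchy_weight_pos[OF x0]
    unfolding set_lebesgue_integral_def set_integrable_def
    by (subst (asm) integral_nonneg_eq_0_iff_AE) (auto intro!: AE_I2 simp: indicator_def less_imp_le)
  then have "AE y in lborel. y \<notin> (D :: (real, 'n) vec set)"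
    by eventually_elim (use cauchy_weight_pos[OF x0] in \<open>fastforce simp: indicator_def\<close>)
  then have "(D :: (real, 'n) vec set) \<in> null_sets lborel"
    by (subst AE_iff_null_sets) (simp_all add: borel_open open_D)
  then have "negligible (D :: (real, 'n) vec set)"
    by (simp add: negligible_iff_null_sets null_sets_completionI)
  then show False
    using open_not_negligible[OF open_D ne] by simp
qed

theorem proposition4p4:
  fixes y :: "real ^ 'n::{finite,linorder}" and t :: real
  assumes "y \<in> D" and "t > 0"
  shows "((\<lambda>x. H_tilde x y) \<longlongrightarrow>
           1 / M TYPE('n) t *
           (\<Prod>j\<in>UNIV. (t\<^sup>2 + (y $ j)\<^sup>2) powi (- int CARD('n))) *
           (\<Prod>(i, j)\<in>{(i, j). i < j}. (y $ i)\<^sup>2 - (y $ j)\<^sup>2))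
         (at (\<chi> i. t) within D)"
proof -
  let ?t = "\<chi> i. t :: (real, 'n) vec"
  have t: "t \<le> ?t $ i" "0 < ?t $ i" for i using \<open>t > 0\<close> by simp_all
  have M: "M TYPE('n) t = (LINT y:D|lborel. cauchy_weight ?t y)"
    by (simp add: M_def limit_weight_eq_cauchy_weight)
  have "((\<lambda>x. cauchy_weight x y / (LINT y':D|lborel. cauchy_weight x y')) \<longlongrightarrow>
      cauchy_weight ?t y / M TYPE('n) t) (at ?t within D)"
    unfolding M
    using isCont_cauchy_weight(1)[OF t(2), of y] \<open>y \<in> D\<close>
    by (intro tendsto_divide tendsto_integral_cauchy_weight[OF t(2)]
        integral_cauchy_weight_nonzero[OF \<open>t > 0\<close> t(1)])
       (auto simp: isCont_def intro: tendsto_within_subset)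
  moreover have "eventually (\<lambda>x. H_tilde x y =
      cauchy_weight x y / (LINT y':D|lborel. cauchy_weight x y')) (at ?t within D)"
    using \<open>y \<in> D\<close> by (auto simp: eventually_at_filter H_tilde_eq_cauchy_weight)
  ultimately have "((\<lambda>x. H_tilde x y) \<longlongrightarrow> cauchy_weight ?t y / M TYPE('n) t) (at ?t within D)"
    by (simp cong: tendsto_cong)
  then show ?thesis
    unfolding limit_weight_eq_cauchy_weight[symmetric] limit_weight_def by simp
qed

end
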